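(* Let $m\ge 1$ and let $N=(n_1,\dots,n_m)$ be a tuple of nonnegative integers with $n_1+\cdots+n_m\ge 1$. Let $\mathcal{H}_N$ be the space of states of light pulses with $m$ propagation modes having exactly $n_i$ photons in mode $i$ for each $i$, and let $\{M_{(r,b)}\}_{r\in\{z,x\},\,b\in\{0,1\}}$ be the POVM elements on $\mathcal{H}_N$ of the ($m$-mode) threshold detector in which double-click events are replaced by a uniformly random bit. Then there exists a squash operator for $\{M_{(r,b)}\}$ compatible with the BB84 protocol. In particular, squash operators exist not only for single-mode ($m=1$) threshold detectors but also for multi-mode threshold detectors.
   Context: Photon space. Each propagation mode $i\in\{1,\dots,m\}$ carries two bosonic creation operators $a^\dagger_{iz0},a^\dagger_{iz1}$ (bit values $0,1$ in the $z$ basis), satisfying the canonical commutation relations, with vacuum $|0\rangle$; all operators belonging to different $i$ or different bit values commute. The creation operators for the $x$ basis are $a^\dagger_{ixb}=\frac{1}{\sqrt2}\left(a^\dagger_{iz0}+(-1)^b a^\dagger_{iz1}\right)$, $b=0,1$. The space $\mathcal{H}_N$ is the (finite-dimensional) subspace of Fock space with exactly $n_i$ photons in mode $i$ (total over the two bit values) for each $i$, i.e. $\mathcal{H}_N\cong\bigotimes_{i=1}^m\mathrm{Sym}^{n_i}(\mathbb{C}^2)$. The threshold detector is block diagonal with respect to the photon number configuration $N$, and each block is treated individually. Threshold detector. For $r\in\{z,x\}$, $b\in\{0,1\}$ let $|N;r,b\rangle:=A_N(a^\dagger_{1rb})^{n_1}(a^\dagger_{2rb})^{n_2}\cdots(a^\dagger_{mrb})^{n_m}|0\rangle$,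 with $A_N>0$ the normalization constant. The detection unit consists of two threshold detectors, one for each bit value $b$; each clicks when it receives at least one photon (in any mode) of bit value $b$ in the chosen basis $r$. If only detector $b$ clicks, the output is $b$; if both click, the output is a uniformly random bit. Thus on $\mathcal{H}_N$ $$M_{(r,b)}=|N;r,b\rangle\langle N;r,b|+\tfrac12\Big(\mathbb{I}-\sum_{b'=0,1}|N;r,b'\rangle\langle N;r,b'|\Big),$$ and the observables $M_r:=M_{(r,0)}-M_{(r,1)}$ are $M_r=|N;r,0\rangle\langle N;r,0|-|N;r,1\rangle\langle N;r,1|$. Squash operator. Let $\mathcal{H}_C=\mathbb{C}^2$ be the qubit space, with Pauli matrices $\sigma_z=\begin{pmatrix}1&0\\0&-1\end{pmatrix}$ and $\sigma_x=\begin{pmatrix}0&1\\1&0\end{pmatrix}$. A squash operator for $\{M_{(r,b)}\}$ (compatible with the BB84 protocol) is a completely positive trace-preserving map $F$ from states on $\mathcal{H}_N$ to states on $\mathcal{H}_C$ such that, for every density operator $\rho$ on $\mathcal{H}_N$, $\mathrm{Tr}(F(\rho)\sigma_r)=\mathrm{Tr}(\rho M_r)$ for $r=z,x$. Equivalently, there are Kraus operators $F_c:\mathcal{H}_N\to\mathcal{H}_C$ with $\sum_c F_c^\dagger\sigma_r F_c=M_r$ for $r=z,x$ and $\sum_c F_c^\dagger F_c=\mathbb{I}$. *)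

theory Defs
  imports "HOL-Analysis.Analysis"
begin

section \<open>Operators on a finite-dimensional Hilbert space with orthonormal basis \<open>I\<close>\<close>

text \<open>
  The Hilbert space is \<open>\<complex>\<^sup>I\<close> for a finite set \<open>I\<close> of basis labels. An operator \<open>A\<close> is given by
  its matrix elements \<open>A x y = \<langle>x| A |y\<rangle>\<close>, which vanish unless both labels lie in \<open>I\<close>.
\<close>

type_synonym 'a oper = "'a \<Rightarrow> 'a \<Rightarrow> complex"

definition opers :: "'a set \<Rightarrow> 'a oper set" where
  "opers I = {A. \<forall>x y. A x y \<noteq> 0 \<longrightarrow> x \<in> I \<and> y \<in> I}"

definition op_mult :: "'a set \<Rightarrow> 'a oper \<Rightarrow> 'a oper \<Rightarrow> 'a oper" where
  "op_mult I A B = (\<lambda>x y. \<Sum>z\<in>I. A x z * B z y)"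

definition op_trace :: "'a set \<Rightarrow> 'a oper \<Rightarrow> complex" where
  "op_trace I A = (\<Sum>x\<in>I. A x x)"

definition op_id :: "'a set \<Rightarrow> 'a oper" where
  "op_id I = (\<lambda>x y. if x = y \<and> x \<in> I then 1 else 0)"

text \<open>Over the complex numbers, \<open>\<langle>v| A |v\<rangle> \<ge> 0\<close> for all \<open>v\<close> already forces \<open>A\<close> to be Hermitian.\<close>

definition positive_op :: "'a set \<Rightarrow> 'a oper \<Rightarrow> bool" where
  "positive_op I A \<longleftrightarrow> A \<in> opers I \<and>
     (\<forall>v :: 'a \<Rightarrow> complex. (\<Sum>x\<in>I. \<Sum>y\<in>I. cnj (v x) * A x y * v y) \<in> \<real>\<^sub>\<ge>\<^sub>0)"

definition density_op :: "'a set \<Rightarrow> 'a oper \<Rightarrow> bool" where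
  "density_op I \<rho> \<longleftrightarrow> positive_op I \<rho> \<and> op_trace I \<rho> = 1"

definition linear_map :: "'a set \<Rightarrow> 'b set \<Rightarrow> ('a oper \<Rightarrow> 'b oper) \<Rightarrow> bool" where
  "linear_map I J F \<longleftrightarrow>
     (\<forall>A\<in>opers I. F A \<in> opers J) \<and>
     (\<forall>A\<in>opers I. \<forall>B\<in>opers I. F (\<lambda>x y. A x y + B x y) = (\<lambda>x y. F A x y + F B x y)) \<and>
     (\<forall>A\<in>opers I. \<forall>c. F (\<lambda>x y. c * A x y) = (\<lambda>x y. c * F A x y))"

text \<open>\<open>id \<otimes> F\<close>: \<open>F\<close> is applied to each block \<open>(s, t)\<close> of an operator on \<open>\<complex>\<^sup>k \<otimes> \<complex>\<^sup>I\<close>.\<close>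

definition ampliation :: "('a oper \<Rightarrow> 'b oper) \<Rightarrow> (nat \<times> 'a) oper \<Rightarrow> (nat \<times> 'b) oper" where
  "ampliation F A = (\<lambda>(s, x) (t, y). F (\<lambda>x' y'. A (s, x') (t, y')) x y)"

definition completely_positive :: "'a set \<Rightarrow> 'b set \<Rightarrow> ('a oper \<Rightarrow> 'b oper) \<Rightarrow> bool" where
  "completely_positive I J F \<longleftrightarrow> linear_map I J F \<and>
     (\<forall>k. \<forall>A. positive_op ({..<k} \<times> I) A \<longrightarrow>
        positive_op ({..<k} \<times> J) (ampliation F A))"

definition trace_preserving :: "'a set \<Rightarrow> 'b set \<Rightarrow> ('a oper \<Rightarrow> 'b oper) \<Rightarrow> bool" where
  "trace_preserving I J F \<longleftrightarrow> (\<forall>A\<in>opers I. op_trace J (F A) = op_trace I A)"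


section \<open>Fock space of \<open>m\<close> modes with two bit values each\<close>

text \<open>
  Bit values are Booleans (\<open>False = 0\<close>, \<open>True = 1\<close>). An occupation assigns to every pair
  \<open>(i, b)\<close> the number of photons in propagation mode \<open>i\<close> with \<open>z\<close>-basis bit value \<open>b\<close>;
  a Fock vector is given by its amplitudes in the orthonormal occupation-number basis.
\<close>

type_synonym occupation = "nat \<times> bool \<Rightarrow> nat"
type_synonym fock = "occupation \<Rightarrow> complex"

datatype bb84_basis = z_basis | x_basis

definition vacuum :: fock where
  "vacuum = (\<lambda>k. if k = (\<lambda>_. 0) then 1 else 0)"

definition create_z :: "nat \<Rightarrow> bool \<Rightarrow> fock \<Rightarrow> fock" where
  "create_z i b \<psi> = (\<lambda>k. if k (i, b) = 0 then 0
     else of_real (sqrt (real (k (i, b)))) * \<psi> (k((i, b) := k (i, b) - 1)))"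

definition annihilate_z :: "nat \<Rightarrow> bool \<Rightarrow> fock \<Rightarrow> fock" where
  "annihilate_z i b \<psi> = (\<lambda>k. of_real (sqrt (real (k (i, b) + 1))) * \<psi> (k((i, b) := k (i, b) + 1)))"

lemma canonical_commutation:
  "annihilate_z i b (create_z j c \<psi>) k - create_z j c (annihilate_z i b \<psi>) k
     = (if (i, b) = (j, c) then \<psi> k else 0)"
proof (cases "(i, b) = (j, c)")
  case True
  have sq: "complex_of_real (sqrt (real n)) * (complex_of_real (sqrt (real n)) * w) = of_nat n * w"
    for n w
  proof -
    have "complex_of_real (sqrt (real n)) * complex_of_real (sqrt (real n)) = of_nat n"
      by (simp flip: of_real_mult)
    then show ?thesis by (metis mult.assoc)
  qed
  have "annihilate_z i b (create_z j c \<psi>) k = of_nat (Suc (k (i, b))) * \<psi> k"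
    using True sq[of "Suc (k (i, b))" "\<psi> k"] by (simp add: annihilate_z_def create_z_def)
  moreover have "create_z j c (annihilate_z i b \<psi>) k = of_nat (k (i, b)) * \<psi> k"
  proof (cases "k (i, b)")
    case (Suc l)
    then have "k((i, b) := Suc l) = k" by (simp add: fun_upd_idem)
    then show ?thesis
      using True Suc sq[of "Suc l" "\<psi> k"]
      by (simp add: annihilate_z_def create_z_def del: of_nat_Suc)
  qed (use True in \<open>simp add: create_z_def\<close>)
  ultimately show ?thesis using True by (simp add: algebra_simps)
next
  case False
  define p q where "p = (i, b)" and "q = (j, c)"
  with False have pq: "p \<noteq> q" by simp
  then have "k(p := u, q := v) = k(q := v, p := u)" for u v
    by (rule fun_upd_twist)
  from this[of "k p + 1" "k q - 1"] pq show ?thesis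
    unfolding annihilate_z_def create_z_def p_def[symmetric] q_def[symmetric] by simp
qed

lemma create_z_commute: "create_z i b (create_z j c \<psi>) = create_z j c (create_z i b \<psi>)"
proof (cases "(i, b) = (j, c)")
  case False
  define p q where "p = (i, b)" and "q = (j, c)"
  with False have pq: "p \<noteq> q" by simp
  show ?thesis
  proof
    fix k :: occupation
    have "k(p := k p - 1, q := k q - 1) = k(q := k q - 1, p := k p - 1)"
      using pq by (rule fun_upd_twist)
    with pq show "create_z i b (create_z j c \<psi>) k = create_z j c (create_z i b \<psi>) k"
      unfolding create_z_def p_def[symmetric] q_def[symmetric] by simp
  qed
qed simp

definition create :: "bb84_basis \<Rightarrow> nat \<Rightarrow> bool \<Rightarrow> fock \<Rightarrow> fock" where
  "create r i b \<psi> = (case r of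
       z_basis \<Rightarrow> create_z i b \<psi>
     | x_basis \<Rightarrow> (\<lambda>k. (create_z i False \<psi> k + (- 1) ^ of_bool b * create_z i True \<psi> k)
                        / of_real (sqrt 2)))"

text \<open>Basis labels of \<open>\<H>\<^sub>N\<close>, where \<open>N = (n 1, \<dots>, n m)\<close>.\<close>

definition occupations :: "nat \<Rightarrow> (nat \<Rightarrow> nat) \<Rightarrow> occupation set" where
  "occupations m n = {k. (\<forall>i\<in>{1..m}. k (i, False) + k (i, True) = n i) \<and>
                         (\<forall>i b. i \<notin> {1..m} \<longrightarrow> k (i, b) = 0)}"

lemma finite_occupations: "finite (occupations m n)"
proof -
  let ?S = "{1..m} \<times> (UNIV :: bool set)" and ?T = "{..(\<Sum>i\<in>{1..m}. n i)}"
  have "k (i, b) \<le> (\<Sum>i\<in>{1..m}. n i)" if k: "k \<in> occupations m n" and i: "i \<in> {1..m}" for k i b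
  proof -
    have "k (i, False) + k (i, True) = n i"
      using k i unfolding occupations_def by blast
    then have "k (i, b) \<le> n i" by (cases b) auto
    also have "n i \<le> (\<Sum>i\<in>{1..m}. n i)"
      using i by (intro member_le_sum) auto
    finally show ?thesis .
  qed
  moreover have "k (i, b) = 0" if "k \<in> occupations m n" "i \<notin> {1..m}" for k i b
    using that unfolding occupations_def by blast
  ultimately have "occupations m n \<subseteq>
      {k. \<forall>p. (p \<in> ?S \<longrightarrow> k p \<in> ?T) \<and> (p \<notin> ?S \<longrightarrow> k p = 0)}"
    by (simp add: subset_iff split_paired_all)
  moreover have "finite {k. \<forall>p. (p \<in> ?S \<longrightarrow> k p \<in> ?T) \<and> (p \<notin> ?S \<longrightarrow> k p = (0 :: nat))}"
    by (rule finite_set_of_finite_funs) auto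
  ultimately show ?thesis by (rule finite_subset)
qed


section \<open>The threshold detector\<close>

text \<open>\<open>(a\<^sup>\<dagger>\<^bsub>1rb\<^esub>)\<^bsup>n 1\<^esup> \<dots> (a\<^sup>\<dagger>\<^bsub>mrb\<^esub>)\<^bsup>n m\<^esup> |0\<rangle>\<close>, before and after normalization.\<close>

definition raw_ket :: "nat \<Rightarrow> (nat \<Rightarrow> nat) \<Rightarrow> bb84_basis \<Rightarrow> bool \<Rightarrow> fock" where
  "raw_ket m n r b = foldr (\<lambda>i \<psi>. (create r i b ^^ n i) \<psi>) [1..<Suc m] vacuum"

definition ket :: "nat \<Rightarrow> (nat \<Rightarrow> nat) \<Rightarrow> bb84_basis \<Rightarrow> bool \<Rightarrow> fock" where
  "ket m n r b = (\<lambda>k. raw_ket m n r b k /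
     of_real (sqrt (\<Sum>k'\<in>occupations m n. (cmod (raw_ket m n r b k'))\<^sup>2)))"

definition projector :: "('a \<Rightarrow> complex) \<Rightarrow> 'a oper" where
  "projector \<psi> = (\<lambda>x y. \<psi> x * cnj (\<psi> y))"

definition threshold_povm ::
    "nat \<Rightarrow> (nat \<Rightarrow> nat) \<Rightarrow> bb84_basis \<Rightarrow> bool \<Rightarrow> occupation oper" where
  "threshold_povm m n r b = (\<lambda>x y. projector (ket m n r b) x y +
     1/2 * (op_id (occupations m n) x y - (\<Sum>b'\<in>UNIV. projector (ket m n r b') x y)))"


section \<open>Squash operators\<close>

definition pauli :: "bb84_basis \<Rightarrow> bool oper" where
  "pauli r = (case r of
       z_basis \<Rightarrow> (\<lambda>x y. if x = y then (if x then - 1 else 1) else 0)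
     | x_basis \<Rightarrow> (\<lambda>x y. if x = y then 0 else 1))"

definition squash_operator ::
    "'a set \<Rightarrow> (bb84_basis \<Rightarrow> bool \<Rightarrow> 'a oper) \<Rightarrow> ('a oper \<Rightarrow> bool oper) \<Rightarrow> bool" where
  "squash_operator I M F \<longleftrightarrow>
     completely_positive I UNIV F \<and> trace_preserving I UNIV F \<and>
     (\<forall>\<rho>. density_op I \<rho> \<longrightarrow> (\<forall>r.
        op_trace UNIV (op_mult UNIV (F \<rho>) (pauli r)) =
        op_trace I (op_mult I \<rho> (\<lambda>x y. M r False x y - M r True x y))))"

end

theory Submission
  imports Defs
begin

text \<open>
  Put \<open>c = (x\<^sub>0 + x\<^sub>1)/\<surd>2\<close> and \<open>d = (x\<^sub>0 - x\<^sub>1)/\<surd>2\<close> for the kets \<open>x\<^sub>b = |N;x,b\<rangle>\<close>, so that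
  \<open>M\<^sub>x = |c\<rangle>\<langle>d| + |d\<rangle>\<langle>c|\<close>. A squash operator amounts to pairs of vectors \<open>(f, g)\<close> with
  \<open>\<Sum>|f\<rangle>\<langle>f| = 1 + M\<^sub>z\<close>, \<open>\<Sum>|g\<rangle>\<langle>g| = 1 - M\<^sub>z\<close> and \<open>\<Sum>(|f\<rangle>\<langle>g| + |g\<rangle>\<langle>f|) = 2 M\<^sub>x\<close>. The overlaps of
  the four kets depend only on the total photon number \<open>n\<close>, and its parity decides which of them
  vanish. For even \<open>n\<close>, \<open>d\<close> is orthogonal to \<open>z\<^sub>0, z\<^sub>1\<close> and \<open>c\<close> has the same overlap \<open>\<theta>\<close> with
  both; the pairs \<open>(c + \<theta>(z\<^sub>0 - z\<^sub>1), d)\<close> and \<open>(d, c - \<theta>(z\<^sub>0 - z\<^sub>1))\<close> produce \<open>2 M\<^sub>x\<close>, and what remains of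
  \<open>1 \<plusminus> M\<^sub>z\<close> is positive. For odd \<open>n\<close>, the planes spanned by \<open>z\<^sub>0, c\<close> and by \<open>z\<^sub>1, d\<close> are
  orthogonal; with \<open>c', c''\<close> completing \<open>z\<^sub>0\<close> and \<open>c\<close>, respectively, to orthonormal bases of the
  first plane, and \<open>d', d''\<close> likewise in the second, the pairs \<open>(c, d)\<close>, \<open>(z\<^sub>0, z\<^sub>1)\<close>,
  \<open>(c'', - d'')\<close>, \<open>(d', c')\<close> work, together with the projection onto the complement of both planes.
\<close>

section \<open>Kraus maps\<close>

text \<open>\<open>K b x\<close> is the matrix element <b|K|x>, so the map is A -> sum of K A
  K^dagger over the list.\<close>

definition kraus_map :: "'a set \<Rightarrow> ('b \<Rightarrow> 'a \<Rightarrow> complex) list \<Rightarrow> 'a oper \<Rightarrow> 'b oper" where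
  "kraus_map I Ks A = (\<lambda>b b'. \<Sum>K\<leftarrow>Ks. \<Sum>x\<in>I. \<Sum>y\<in>I. K b x * A x y * cnj (K b' y))"

lemma sum_list_nonneg_Reals:
  "(\<And>x. x \<in> set xs \<Longrightarrow> f x \<in> \<real>\<^sub>\<ge>\<^sub>0) \<Longrightarrow> (\<Sum>x\<leftarrow>xs. f x) \<in> (\<real>\<^sub>\<ge>\<^sub>0 :: complex set)"
  by (induction xs) auto

lemma sum_sum_list_swap:
  "(\<Sum>x\<in>A. \<Sum>y\<leftarrow>ys. f x y) = (\<Sum>y\<leftarrow>ys. \<Sum>x\<in>A. f x y :: 'c :: comm_monoid_add)"
  by (induction ys) (auto simp: sum.distrib)

lemma linear_map_kraus_map:
  fixes Ks :: "('b :: finite \<Rightarrow> 'a \<Rightarrow> complex) list"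
  shows "linear_map I UNIV (kraus_map I Ks)"
proof -
  have "kraus_map I Ks (\<lambda>x y. A x y + B x y) b b' = kraus_map I Ks A b b' + kraus_map I Ks B b b'"
    for A B b b'
    by (simp add: kraus_map_def algebra_simps sum.distrib sum_list_addf)
  moreover have "kraus_map I Ks (\<lambda>x y. c * A x y) b b' = c * kraus_map I Ks A b b'" for c A b b'
    by (simp add: kraus_map_def mult_ac sum_list_const_mult flip: sum_distrib_left)
  ultimately show ?thesis
    unfolding linear_map_def by (simp add: opers_def fun_eq_iff)
qed

text \<open>Moving each K onto the test vector turns the form of (id (x) F)(A) at v into a sum of
  forms of A at the vectors (1 (x) K^dagger) v. Complete positivity then only needs positivity of
  A.\<close>

lemma ampliation_kraus_map_form:
  fixes Ks :: "('b :: finite \<Rightarrow> 'a \<Rightarrow> complex) list"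
  shows "(\<Sum>p\<in>{..<k} \<times> UNIV. \<Sum>q\<in>{..<k} \<times> UNIV.
            cnj (v p) * ampliation (kraus_map I Ks) A p q * v q) =
    (\<Sum>K\<leftarrow>Ks. \<Sum>p\<in>{..<k} \<times> I. \<Sum>q\<in>{..<k} \<times> I.
       cnj (\<Sum>b\<in>UNIV. cnj (K b (snd p)) * v (fst p, b)) * A p q *
       (\<Sum>b\<in>UNIV. cnj (K b (snd q)) * v (fst q, b)))"
proof -
  have "(\<Sum>p\<in>{..<k} \<times> UNIV. \<Sum>q\<in>{..<k} \<times> UNIV.
            cnj (v p) * ampliation (kraus_map I Ks) A p q * v q) =
    (\<Sum>K\<leftarrow>Ks. \<Sum>p\<in>{..<k} \<times> UNIV. \<Sum>q\<in>{..<k} \<times> UNIV. \<Sum>x\<in>I. \<Sum>y\<in>I.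
       cnj (v p) * (K (snd p) x * A (fst p, x) (fst q, y) * cnj (K (snd q) y)) * v q)"
    by (simp add: ampliation_def kraus_map_def split_def
        sum_distrib_left sum_distrib_right sum_sum_list_swap flip: sum_list_const_mult sum_list_mult_const)
  also have "\<dots> = (\<Sum>K\<leftarrow>Ks. \<Sum>p\<in>{..<k} \<times> I. \<Sum>q\<in>{..<k} \<times> I.
       cnj (\<Sum>b\<in>UNIV. cnj (K b (snd p)) * v (fst p, b)) * A p q *
       (\<Sum>b\<in>UNIV. cnj (K b (snd q)) * v (fst q, b)))"
  proof (intro arg_cong[where f = sum_list] map_cong refl)
    fix K
    define h where "h s x t y b b' =
       cnj (v (s, b)) * (K b x * A (s, x) (t, y) * cnj (K b' y)) * v (t, b')" for s x t y b b'
    have "(\<Sum>p\<in>{..<k} \<times> UNIV. \<Sum>q\<in>{..<k} \<times> UNIV. \<Sum>x\<in>I. \<Sum>y\<in>I.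
       cnj (v p) * (K (snd p) x * A (fst p, x) (fst q, y) * cnj (K (snd q) y)) * v q)
      = (\<Sum>s<k. \<Sum>b\<in>UNIV. \<Sum>t<k. \<Sum>b'\<in>UNIV. \<Sum>x\<in>I. \<Sum>y\<in>I. h s x t y b b')"
      by (simp add: h_def sum.cartesian_product')
    also have "\<dots> = (\<Sum>s<k. \<Sum>x\<in>I. \<Sum>t<k. \<Sum>y\<in>I. \<Sum>b\<in>UNIV. \<Sum>b'\<in>UNIV. h s x t y b b')"
      by (simp only: sum.swap[of _ "{..<k}" "UNIV :: 'b set"] sum.swap[of _ I "UNIV :: 'b set"]
          sum.swap[of _ "{..<k}" I])
    also have "\<dots> = (\<Sum>p\<in>{..<k} \<times> I. \<Sum>q\<in>{..<k} \<times> I.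
       cnj (\<Sum>b\<in>UNIV. cnj (K b (snd p)) * v (fst p, b)) * A p q *
       (\<Sum>b\<in>UNIV. cnj (K b (snd q)) * v (fst q, b)))"
      by (simp add: h_def sum_distrib_left sum_distrib_right mult_ac sum.cartesian_product')
    finally show "(\<Sum>p\<in>{..<k} \<times> UNIV. \<Sum>q\<in>{..<k} \<times> UNIV. \<Sum>x\<in>I. \<Sum>y\<in>I.
       cnj (v p) * (K (snd p) x * A (fst p, x) (fst q, y) * cnj (K (snd q) y)) * v q) =
       (\<Sum>p\<in>{..<k} \<times> I. \<Sum>q\<in>{..<k} \<times> I.
       cnj (\<Sum>b\<in>UNIV. cnj (K b (snd p)) * v (fst p, b)) * A p q *
       (\<Sum>b\<in>UNIV. cnj (K b (snd q)) * v (fst q, b)))" .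
  qed
  finally show ?thesis .
qed

lemma completely_positive_kraus_map:
  fixes Ks :: "('b :: finite \<Rightarrow> 'a \<Rightarrow> complex) list"
  shows "completely_positive I UNIV (kraus_map I Ks)"
  unfolding completely_positive_def
proof (intro conjI allI impI linear_map_kraus_map)
  fix k and A :: "(nat \<times> 'a) oper"
  assume A: "positive_op ({..<k} \<times> I) A"
  have "ampliation (kraus_map I Ks) A \<in> opers ({..<k} \<times> UNIV)"
  proof -
    have zero: "A (s, x) (t, y) = 0" if "\<not> (s < k \<and> t < k)" for s x t y
      using A that by (auto simp: positive_op_def opers_def)
    have "ampliation (kraus_map I Ks) A (s, b) (t, b') = 0" if "\<not> (s < k \<and> t < k)" for s b t b'
      using zero[OF that] by (simp add: ampliation_def kraus_map_def)
    then show ?thesis by (auto simp: opers_def)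
  qed
  moreover have "(\<Sum>p\<in>{..<k} \<times> UNIV. \<Sum>q\<in>{..<k} \<times> UNIV.
            cnj (v p) * ampliation (kraus_map I Ks) A p q * v q) \<in> \<real>\<^sub>\<ge>\<^sub>0" for v
    unfolding ampliation_kraus_map_form
  proof (rule sum_list_nonneg_Reals)
    fix K :: "'b \<Rightarrow> 'a \<Rightarrow> complex"
    show "(\<Sum>p\<in>{..<k} \<times> I. \<Sum>q\<in>{..<k} \<times> I.
       cnj (\<Sum>b\<in>UNIV. cnj (K b (snd p)) * v (fst p, b)) * A p q *
       (\<Sum>b\<in>UNIV. cnj (K b (snd q)) * v (fst q, b))) \<in> \<real>\<^sub>\<ge>\<^sub>0"
      using A unfolding positive_op_def
      by (elim conjE allE[where x = "\<lambda>p. \<Sum>b\<in>UNIV. cnj (K b (snd p)) * v (fst p, b)"])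
  qed
  ultimately show "positive_op ({..<k} \<times> UNIV) (ampliation (kraus_map I Ks) A)"
    unfolding positive_op_def by blast
qed

text \<open>Cyclicity of the trace: Tr(F(A) X) = Tr(A M) with M the sum of K^dagger X K. Pauli
  matrices for \<open>X\<close> give the detector conditions, the identity gives trace
  preservation.\<close>

lemma trace_kraus_map:
  fixes Ks :: "('b :: finite \<Rightarrow> 'a \<Rightarrow> complex) list"
  assumes "\<And>x y. x \<in> I \<Longrightarrow> y \<in> I \<Longrightarrow>
     (\<Sum>K\<leftarrow>Ks. \<Sum>b\<in>UNIV. \<Sum>b'\<in>UNIV. cnj (K b' y) * X b' b * K b x) = M y x"
  shows "op_trace UNIV (op_mult UNIV (kraus_map I Ks A) X) = op_trace I (op_mult I A M)"
proof -
  have "op_trace UNIV (op_mult UNIV (kraus_map I Ks A) X) =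
     (\<Sum>K\<leftarrow>Ks. \<Sum>b\<in>UNIV. \<Sum>b'\<in>UNIV. \<Sum>x\<in>I. \<Sum>y\<in>I. A x y * (cnj (K b' y) * X b' b * K b x))"
    by (simp add: op_trace_def op_mult_def kraus_map_def sum_sum_list_swap sum_distrib_left mult_ac
        flip: sum_list_const_mult)
  also have "\<dots> = (\<Sum>K\<leftarrow>Ks. \<Sum>x\<in>I. \<Sum>y\<in>I. A x y *
       (\<Sum>b\<in>UNIV. \<Sum>b'\<in>UNIV. cnj (K b' y) * X b' b * K b x))"
    unfolding sum_distrib_left
    by (subst sum.swap[of _ I "UNIV :: 'b set"], subst sum.swap[of _ I "UNIV :: 'b set"],
        subst sum.swap[of _ I "UNIV :: 'b set"], subst sum.swap[of _ I "UNIV :: 'b set"]) (rule refl)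
  also have "\<dots> = (\<Sum>x\<in>I. \<Sum>y\<in>I. A x y *
       (\<Sum>K\<leftarrow>Ks. \<Sum>b\<in>UNIV. \<Sum>b'\<in>UNIV. cnj (K b' y) * X b' b * K b x))"
    by (simp add: sum_sum_list_swap flip: sum_list_const_mult)
  also have "\<dots> = (\<Sum>x\<in>I. \<Sum>y\<in>I. A x y * M y x)"
    by (intro sum.cong refl) (simp add: assms)
  finally show ?thesis by (simp add: op_trace_def op_mult_def)
qed

text \<open>
  The pair \<open>(f, g)\<close> stands for the Kraus operator \<open>(|0\<rangle>\<langle>f| + |1\<rangle>\<langle>g|) / \<surd>2\<close>.
\<close>

lemma squash_operator_exists_if:
  fixes ps :: "(('a \<Rightarrow> complex) \<times> ('a \<Rightarrow> complex)) list"
  assumes I: "finite I"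
    and ff: "\<And>x y. x \<in> I \<Longrightarrow> y \<in> I \<Longrightarrow> (\<Sum>p\<leftarrow>ps. fst p x * cnj (fst p y)) =
       of_bool (x = y) + (M z_basis False x y - M z_basis True x y)"
    and gg: "\<And>x y. x \<in> I \<Longrightarrow> y \<in> I \<Longrightarrow> (\<Sum>p\<leftarrow>ps. snd p x * cnj (snd p y)) =
       of_bool (x = y) - (M z_basis False x y - M z_basis True x y)"
    and fg: "\<And>x y. x \<in> I \<Longrightarrow> y \<in> I \<Longrightarrow>
       (\<Sum>p\<leftarrow>ps. fst p x * cnj (snd p y) + snd p x * cnj (fst p y)) =
       2 * (M x_basis False x y - M x_basis True x y)"
  shows "\<exists>F. squash_operator I M F"
proof
  \<comment> \<open>Conjugation turns the kets f, g into bras. The factor 1 / sqrt 2 compensates for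
    the sums of |f><f| and |g><g| adding up to twice the identity.\<close>
  define K where "K p b x = cnj ((if b then snd p else fst p) x) / of_real (sqrt 2)"
    for p :: "('a \<Rightarrow> complex) \<times> ('a \<Rightarrow> complex)" and b x
  define Ks where "Ks = map K ps"
  have half: "cnj (K p b x) * X * K p b' y =
      X * (if b then snd p else fst p) x * cnj ((if b' then snd p else fst p) y) / 2" for p b b' x y X
    by (simp add: K_def flip: of_real_mult)
  have *: "(\<Sum>L\<leftarrow>Ks. \<Sum>b\<in>UNIV. \<Sum>b'\<in>UNIV. cnj (L b' y) * X b' b * L b x) =
     (X False False * (\<Sum>p\<leftarrow>ps. fst p y * cnj (fst p x)) +
      X True True * (\<Sum>p\<leftarrow>ps. snd p y * cnj (snd p x)) +
      X False True * (\<Sum>p\<leftarrow>ps. fst p y * cnj (snd p x)) +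
      X True False * (\<Sum>p\<leftarrow>ps. snd p y * cnj (fst p x))) / 2" for X :: "bool oper" and x y
    unfolding Ks_def
  proof (induction ps)
    case (Cons p ps)
    then show ?case by (simp add: half UNIV_bool) (simp add: field_simps)
  qed simp
  have "op_trace UNIV (op_mult UNIV (kraus_map I Ks \<rho>) (pauli r)) =
      op_trace I (op_mult I \<rho> (\<lambda>x y. M r False x y - M r True x y))" for r \<rho>
  proof (rule trace_kraus_map)
    fix x y assume "x \<in> I" "y \<in> I"
    then show "(\<Sum>L\<leftarrow>Ks. \<Sum>b\<in>UNIV. \<Sum>b'\<in>UNIV. cnj (L b' y) * pauli r b' b * L b x) =
        M r False y x - M r True y x"
      unfolding * using fg[of y x] by (cases r) (simp_all add: pauli_def ff gg sum_list_addf)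
  qed
  moreover have "trace_preserving I UNIV (kraus_map I Ks)"
    unfolding trace_preserving_def
  proof
    fix A :: "'a oper"
    let ?one = "\<lambda>x y. of_bool (x = y)"
    have "op_trace UNIV (op_mult UNIV (kraus_map I Ks A) ?one) = op_trace I (op_mult I A ?one)"
    proof (rule trace_kraus_map)
      fix x y assume "x \<in> I" "y \<in> I"
      then show "(\<Sum>L\<leftarrow>Ks. \<Sum>b\<in>UNIV. \<Sum>b'\<in>UNIV. cnj (L b' y) * ?one b' b * L b x) = ?one y x"
        unfolding * using ff[of y x] gg[of y x] by simp
    qed
    then show "op_trace UNIV (kraus_map I Ks A) = op_trace I A"
      using I by (simp add: op_trace_def op_mult_def)
  qed
  ultimately show "squash_operator I M (kraus_map I Ks)"
    by (simp add: squash_operator_def completely_positive_kraus_map)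
qed

section \<open>Complementary projections\<close>

definition ip :: "'a set \<Rightarrow> ('a \<Rightarrow> complex) \<Rightarrow> ('a \<Rightarrow> complex) \<Rightarrow> complex" where
  "ip I v w = (\<Sum>x\<in>I. cnj (v x) * w x)"

lemma ip_simps:
  "ip I v (\<lambda>x. f x + g x) = ip I v f + ip I v g"
  "ip I v (\<lambda>x. f x - g x) = ip I v f - ip I v g"
  "ip I v (\<lambda>x. a * f x) = a * ip I v f"
  "ip I v (\<lambda>x. f x / a) = ip I v f / a"
  "ip I (\<lambda>x. f x + g x) v = ip I f v + ip I g v"
  "ip I (\<lambda>x. f x - g x) v = ip I f v - ip I g v"
  "ip I (\<lambda>x. a * f x) v = cnj a * ip I f v"
  "ip I (\<lambda>x. f x / a) v = ip I f v / cnj a"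
  by (simp_all add: ip_def algebra_simps sum.distrib sum_subtractf sum_distrib_left sum_divide_distrib)

lemma cnj_ip: "cnj (ip I v w) = ip I w v"
  by (simp add: ip_def mult.commute)

text \<open>
  Vectors that vanish on \<open>I\<close> are admitted, so that degenerate configurations (a single photon)
  need no separate treatment.
\<close>

fun orthosystem :: "'a set \<Rightarrow> ('a \<Rightarrow> complex) list \<Rightarrow> bool" where
  "orthosystem I [] \<longleftrightarrow> True"
| "orthosystem I (u # us) \<longleftrightarrow>
     (\<forall>v\<in>set us. ip I v u = 0) \<and> (ip I u u = 1 \<or> (\<forall>x\<in>I. u x = 0)) \<and> orthosystem I us"

definition compl :: "('a \<Rightarrow> complex) list \<Rightarrow> 'a oper" where
  "compl us x y = of_bool (x = y) - (\<Sum>u\<leftarrow>us. u x * cnj (u y))"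

lemma compl_fixes:
  assumes "finite I" "x \<in> I" "\<forall>u\<in>set us. ip I u w = 0"
  shows "(\<Sum>e\<in>I. compl us x e * w e) = w x"
  using assms(3)
proof (induction us)
  case Nil
  then show ?case using assms by (simp add: compl_def)
next
  case (Cons u us)
  have "(\<Sum>e\<in>I. compl (u # us) x e * w e) = (\<Sum>e\<in>I. compl us x e * w e) - u x * ip I u w"
    by (simp add: compl_def ip_def algebra_simps sum_subtractf sum.distrib sum_distrib_left)
  then show ?case using Cons by simp
qed

text \<open>The remaining projection fixes u, so subtracting |u><u| leaves an idempotent if u has
  norm 1 and changes nothing if u vanishes on \<open>I\<close>. The conjugate makes this P P^dagger
  = P, which exhibits P as the sum of |p><p| over its columns p.\<close>

lemma compl_idempotent:
  assumes "finite I" "x \<in> I" "y \<in> I" "orthosystem I us"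
  shows "(\<Sum>e\<in>I. compl us x e * cnj (compl us y e)) = compl us x y"
  using assms(4)
proof (induction us)
  case Nil
  then show ?case using assms by (simp add: compl_def)
next
  case (Cons u us)
  have Cons_eq: "compl (u # us) a b = compl us a b - u a * cnj (u b)" for a b
    by (simp add: compl_def)
  have fix_u: "(\<Sum>e\<in>I. compl us a e * u e) = u a" if "a \<in> I" for a
    using Cons.prems assms(1) that by (intro compl_fixes) auto
  have fix_u': "(\<Sum>e\<in>I. cnj (compl us a e) * cnj (u e)) = cnj (u a)" if "a \<in> I" for a
    using arg_cong[OF fix_u[OF that], of cnj] by simp
  have "(\<Sum>e\<in>I. compl (u # us) x e * cnj (compl (u # us) y e)) =
      (\<Sum>e\<in>I. compl us x e * cnj (compl us y e)) - cnj (u y) * (\<Sum>e\<in>I. compl us x e * u e)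
       - u x * (\<Sum>e\<in>I. cnj (compl us y e) * cnj (u e)) + u x * cnj (u y) * ip I u u"
    unfolding Cons_eq
    by (simp add: ip_def algebra_simps sum_subtractf sum.distrib sum_distrib_left)
  also have "\<dots> = compl us x y - 2 * u x * cnj (u y) + u x * cnj (u y) * ip I u u"
    using Cons assms by (simp add: fix_u fix_u')
  also have "\<dots> = compl (u # us) x y"
    using Cons.prems assms by (auto simp: Cons_eq)
  finally show ?case .
qed

text \<open>With P = \<open>compl us\<close>, the witnesses are the columns of B = P + a |z><w|.
  Since P w = w, the right-hand side is exactly B B^dagger.\<close>

lemma ex_rows_compl_plus:
  assumes I: "finite I" and us: "orthosystem I us" and w: "\<forall>u\<in>set us. ip I u w = 0"
  shows "\<exists>fs. \<forall>x\<in>I. \<forall>y\<in>I. (\<Sum>f\<leftarrow>fs. f x * cnj (f y)) =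
     compl us x y + of_real a * (w x * cnj (z y) + z x * cnj (w y)) +
     (of_real a)\<^sup>2 * (z x * cnj (z y)) * ip I w w"
proof -
  define f where "f e x = compl us x e + of_real a * z x * cnj (w e)" for e x
  obtain es where es: "set es = I" "distinct es"
    using finite_distinct_list[OF I] by blast
  have "(\<Sum>g\<leftarrow>map f es. g x * cnj (g y)) =
     compl us x y + of_real a * (w x * cnj (z y) + z x * cnj (w y)) +
     (of_real a)\<^sup>2 * (z x * cnj (z y)) * ip I w w" if "x \<in> I" "y \<in> I" for x y
  proof -
    have fix': "(\<Sum>e\<in>I. cnj (compl us y e) * cnj (w e)) = cnj (w y)"
      using arg_cong[OF compl_fixes[OF I \<open>y \<in> I\<close> w], of cnj] by simp
    have "(\<Sum>g\<leftarrow>map f es. g x * cnj (g y)) = (\<Sum>e\<in>I. f e x * cnj (f e y))"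
      using es by (simp add: o_def sum_list_distinct_conv_sum_set)
    also have "\<dots> = (\<Sum>e\<in>I. compl us x e * cnj (compl us y e))
        + of_real a * cnj (z y) * (\<Sum>e\<in>I. compl us x e * w e)
        + of_real a * z x * (\<Sum>e\<in>I. cnj (compl us y e) * cnj (w e))
        + (of_real a)\<^sup>2 * (z x * cnj (z y)) * ip I w w"
      by (simp add: f_def ip_def algebra_simps power2_eq_square sum.distrib sum_distrib_left)
    also have "\<dots> = compl us x y + of_real a * (w x * cnj (z y) + z x * cnj (w y)) +
        (of_real a)\<^sup>2 * (z x * cnj (z y)) * ip I w w"
      using compl_idempotent[OF I that us] compl_fixes[OF I \<open>x \<in> I\<close> w] fix'
      by (simp add: algebra_simps)
    finally show ?thesis .
  qed
  then show ?thesis by blast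
qed

corollary ex_rows_compl:
  assumes "finite I" "orthosystem I us"
  shows "\<exists>fs. \<forall>x\<in>I. \<forall>y\<in>I. (\<Sum>f\<leftarrow>fs. f x * cnj (f y)) = compl us x y"
  using ex_rows_compl_plus[OF assms, of "\<lambda>_. 0" 0 "\<lambda>_. 0"] by (simp add: ip_def)

section \<open>Even photon number\<close>

text \<open>
  With \<open>D = 1 + |z\<rangle>\<langle>z| - |z'\<rangle>\<langle>z'|\<close> and the unit vector
  \<open>\<alpha> = D\<^sup>-\<^sup>\<onehalf> (c + \<theta> (z - z'))\<close>, the claimed operator is \<open>D\<^sup>\<onehalf> P D\<^sup>\<onehalf>\<close> for the projection \<open>P\<close>
  onto the complement of \<open>z'\<close>, \<open>\<alpha>\<close>, \<open>d\<close>; on that complement \<open>D\<^sup>\<onehalf>\<close> is \<open>1 + (\<surd>2 - 1) |z\<rangle>\<langle>z|\<close>.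
\<close>

lemma ex_rows_even:
  fixes \<theta> :: real
  assumes I: "finite I"
    and ips: "ip I z z = 1" "ip I z' z' = 1" "ip I z z' = 0"
      "ip I c c = 1" "ip I d d = 1" "ip I c d = 0"
      "ip I z c = of_real \<theta>" "ip I z' c = of_real \<theta>" "ip I z d = 0" "ip I z' d = 0"
  defines "a \<equiv> \<lambda>x. c x + of_real \<theta> * z x - of_real \<theta> * z' x"
  shows "\<exists>fs. \<forall>x\<in>I. \<forall>y\<in>I. (\<Sum>f\<leftarrow>fs. f x * cnj (f y)) =
     of_bool (x = y) + z x * cnj (z y) - z' x * cnj (z' y) - a x * cnj (a y) - d x * cnj (d y)"
proof -
  define s where "s = complex_of_real (sqrt 2)"
  have s: "s * s = 2" "cnj s = s"
    by (simp_all add: s_def flip: of_real_mult)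
  have ss: "s * (s * v) = 2 * v" for v
    using s(1) by (simp flip: mult.assoc)
  define t where "t = complex_of_real \<theta>"
  have t: "cnj t = t" by (simp add: t_def)
  \<comment> \<open>The vector \<open>a\<close> is orthogonal to \<open>z'\<close> and has
    z-component 2 \<theta>, which the inverse root of D divides by sqrt 2. The norm is 1 for every
    \<theta>: 1 - 2 \<theta>^2 from the part of c off z and z', plus 2 \<theta>^2 along z.\<close>
  define \<alpha> where "\<alpha> x = c x + (s - 1) * t * z x - t * z' x" for x
  \<comment> \<open>This is P z, as z has overlap \<open>s * t\<close> with \<alpha> and none with
    \<open>z'\<close> and d. Hence P + (sqrt 2 - 1) |z><w| is the root of D times P.\<close>
  define w where "w x = z x - s * t * \<alpha> x" for x
  have sym: "ip I z' z = 0" "ip I d c = 0" "ip I c z = t" "ip I c z' = t" "ip I d z = 0" "ip I d z' = 0"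
    using ips(3,6-10)[THEN arg_cong, of cnj] by (simp_all add: cnj_ip t_def)
  note ips' = ips[folded t_def] sym
  have \<alpha>: "ip I v \<alpha> = ip I v c + (s - 1) * t * ip I v z - t * ip I v z'"
    "ip I \<alpha> v = ip I c v + (s - 1) * t * ip I z v - t * ip I z' v" for v
    unfolding \<alpha>_def by (simp_all only: ip_simps complex_cnj_mult complex_cnj_diff complex_cnj_one s t)
  have w: "ip I v w = ip I v z - s * t * ip I v \<alpha>" "ip I w v = ip I z v - s * t * ip I \<alpha> v" for v
    unfolding w_def by (simp_all only: ip_simps complex_cnj_mult s t)
  have \<alpha>\<alpha>: "ip I \<alpha> \<alpha> = 1"
    by (simp add: \<alpha> ips' algebra_simps s ss)
  have \<alpha>z: "ip I \<alpha> z = s * t" "ip I z \<alpha> = s * t" "ip I z' \<alpha> = 0" "ip I \<alpha> z' = 0" "ip I d \<alpha> = 0" "ip I \<alpha> d = 0"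
    by (simp_all add: \<alpha> ips' algebra_simps)
  have ww: "ip I w w = 1 - 2 * t * t"
    by (simp add: w \<alpha>z \<alpha>\<alpha> ips' algebra_simps s ss)
  have "orthosystem I [z', \<alpha>, d]"
    by (simp add: \<alpha>z \<alpha>\<alpha> ips')
  moreover have "\<forall>u\<in>set [z', \<alpha>, d]. ip I u w = 0"
    by (simp add: w \<alpha>z \<alpha>\<alpha> ips')
  ultimately obtain fs where fs: "(\<Sum>f\<leftarrow>fs. f x * cnj (f y)) =
     compl [z', \<alpha>, d] x y + of_real (sqrt 2 - 1) * (w x * cnj (z y) + z x * cnj (w y)) +
     (of_real (sqrt 2 - 1))\<^sup>2 * (z x * cnj (z y)) * ip I w w" if "x \<in> I" "y \<in> I" for x y
    using ex_rows_compl_plus[OF I] by meson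
  have "(\<Sum>f\<leftarrow>fs. f x * cnj (f y)) =
     of_bool (x = y) + z x * cnj (z y) - z' x * cnj (z' y) - a x * cnj (a y) - d x * cnj (d y)"
    if "x \<in> I" "y \<in> I" for x y
  proof -
    show ?thesis
      by (simp add: fs[OF that] ww compl_def w_def \<alpha>_def a_def power2_eq_square s t
          flip: s_def t_def) (simp add: algebra_simps s ss)
  qed
  then show ?thesis by blast
qed

lemma squash_operator_exists_even:
  fixes \<theta> :: real
  assumes I: "finite I"
    and ips: "ip I z0 z0 = 1" "ip I z1 z1 = 1" "ip I z0 z1 = 0"
      "ip I c c = 1" "ip I d d = 1" "ip I c d = 0"
      "ip I z0 c = of_real \<theta>" "ip I z1 c = of_real \<theta>" "ip I z0 d = 0" "ip I z1 d = 0"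
    and Mz: "\<And>x y. x \<in> I \<Longrightarrow> y \<in> I \<Longrightarrow> M z_basis False x y - M z_basis True x y =
        z0 x * cnj (z0 y) - z1 x * cnj (z1 y)"
    and Mx: "\<And>x y. x \<in> I \<Longrightarrow> y \<in> I \<Longrightarrow> M x_basis False x y - M x_basis True x y =
        c x * cnj (d y) + d x * cnj (c y)"
  shows "\<exists>F. squash_operator I M F"
proof -
  define a where "a x = c x + of_real \<theta> * z0 x - of_real \<theta> * z1 x" for x
  define b where "b x = c x + of_real \<theta> * z1 x - of_real \<theta> * z0 x" for x
  have sym: "ip I z1 z0 = 0"
    using ips(3)[THEN arg_cong, of cnj] by (simp add: cnj_ip)
  obtain fs where fs: "(\<Sum>f\<leftarrow>fs. f x * cnj (f y)) = of_bool (x = y) + z0 x * cnj (z0 y)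
      - z1 x * cnj (z1 y) - a x * cnj (a y) - d x * cnj (d y)" if "x \<in> I" "y \<in> I" for x y
    using ex_rows_even[OF I ips] unfolding a_def by meson
  obtain gs where gs: "(\<Sum>g\<leftarrow>gs. g x * cnj (g y)) = of_bool (x = y) + z1 x * cnj (z1 y)
      - z0 x * cnj (z0 y) - b x * cnj (b y) - d x * cnj (d y)" if "x \<in> I" "y \<in> I" for x y
    using ex_rows_even[OF I ips(2,1) sym ips(4-6,8,7,10,9)] unfolding b_def by meson
  \<comment> \<open>As a + b = 2 c, the cross terms of (a, d) and (d, b) add up to 2 M_x. Vectors
    paired with zero affect only the two diagonal sums.\<close>
  show ?thesis
    by (rule squash_operator_exists_if[OF I, where
          ps = "(a, d) # (d, b) # map (\<lambda>f. (f, \<lambda>_. 0)) fs @ map (\<lambda>g. (\<lambda>_. 0, g)) gs"])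
      (simp_all add: o_def fs gs Mz Mx, simp add: a_def b_def algebra_simps)
qed

section \<open>Odd photon number\<close>

text \<open>
  If \<open>c\<close> and \<open>z\<close> are unit vectors with overlap \<open>\<eta>\<close>, then \<open>tilt \<eta> c z\<close> completes \<open>z\<close> to an
  orthonormal basis of their span; it is the zero vector if \<open>\<eta> = 1\<close>, as \<open>x / 0 = 0\<close>.
\<close>

definition tilt :: "real \<Rightarrow> ('a \<Rightarrow> complex) \<Rightarrow> ('a \<Rightarrow> complex) \<Rightarrow> 'a \<Rightarrow> complex" where
  "tilt \<eta> c z = (\<lambda>x. (c x - of_real \<eta> * z x) / of_real (sqrt (1 - \<eta>\<^sup>2)))"

text \<open>Two planes spanned by unit vectors with the same overlap \<eta> have the same change of
  basis from (z, tilt) to (c, tilt). The isometry carrying one plane to the other therefore has the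
  same form in both bases; with equal planes it is the projection.\<close>

lemma tilt_basis_change:
  assumes \<eta>: "0 \<le> \<eta>" "\<eta> \<le> 1" and deg: "\<eta> = 1 \<Longrightarrow> c x = z x \<and> c' y = z' y"
  shows "z x * cnj (z' y) + tilt \<eta> c z x * cnj (tilt \<eta> c' z' y) =
     c x * cnj (c' y) + tilt \<eta> z c x * cnj (tilt \<eta> z' c' y)"
proof (cases "\<eta> = 1")
  case True
  then show ?thesis using deg by (simp add: tilt_def)
next
  case False
  then have "\<eta>\<^sup>2 < 1" using \<eta> by (simp add: power_less_one_iff)
  define \<delta> where "\<delta> = complex_of_real (sqrt (1 - \<eta>\<^sup>2))"
  have \<delta>: "cnj \<delta> = \<delta>" "\<delta> * \<delta> = 1 - (of_real \<eta>)\<^sup>2" "\<delta> \<noteq> 0"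
    using \<open>\<eta>\<^sup>2 < 1\<close> by (simp_all add: \<delta>_def flip: of_real_mult)
  let ?e = "complex_of_real \<eta>"
  have "tilt \<eta> c z x * cnj (tilt \<eta> c' z' y) - tilt \<eta> z c x * cnj (tilt \<eta> z' c' y) =
     ((c x - ?e * z x) * (cnj (c' y) - ?e * cnj (z' y)) -
      (z x - ?e * c x) * (cnj (z' y) - ?e * cnj (c' y))) / (\<delta> * \<delta>)"
    unfolding tilt_def \<delta>_def[symmetric] by (simp add: \<delta>(1) flip: diff_divide_distrib)
  also have "\<dots> = (\<delta> * \<delta>) * (c x * cnj (c' y) - z x * cnj (z' y)) / (\<delta> * \<delta>)"
    by (rule arg_cong[where f = "\<lambda>v. v / (\<delta> * \<delta>)"], unfold \<delta>(2))
      (simp add: power2_eq_square algebra_simps)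
  also have "\<dots> = c x * cnj (c' y) - z x * cnj (z' y)"
    using \<delta>(3) by simp
  finally show ?thesis by (simp add: algebra_simps)
qed

text \<open>Equality case of Cauchy-Schwarz: |c - z|^2 = 1 - 1 - 1 + 1 = 0.\<close>

lemma eq_if_ip_eq_1:
  assumes I: "finite I" and "ip I z z = 1" "ip I c c = 1" "ip I z c = 1" "x \<in> I"
  shows "c x = z x"
proof -
  have "ip I c z = 1" using assms cnj_ip by (metis complex_cnj_one)
  then have "ip I (\<lambda>x. c x - z x) (\<lambda>x. c x - z x) = 0"
    using assms by (simp add: ip_simps)
  moreover have "ip I (\<lambda>x. c x - z x) (\<lambda>x. c x - z x) = of_real (\<Sum>x\<in>I. (cmod (c x - z x))\<^sup>2)"
    unfolding ip_def of_real_sum by (intro sum.cong refl) (metis complex_norm_square mult.commute)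
  ultimately have "(\<Sum>x\<in>I. (cmod (c x - z x))\<^sup>2) = 0"
    by (simp del: of_real_sum)
  then show ?thesis using I \<open>x \<in> I\<close> by (simp add: sum_nonneg_eq_0_iff)
qed

lemma squash_operator_exists_odd:
  fixes \<eta> :: real
  assumes I: "finite I" and \<eta>: "0 \<le> \<eta>" "\<eta> \<le> 1"
    and ips: "ip I z0 z0 = 1" "ip I z1 z1 = 1" "ip I z0 z1 = 0"
      "ip I c c = 1" "ip I d d = 1" "ip I c d = 0"
      "ip I z0 c = of_real \<eta>" "ip I z1 d = of_real \<eta>" "ip I z0 d = 0" "ip I z1 c = 0"
    and Mz: "\<And>x y. x \<in> I \<Longrightarrow> y \<in> I \<Longrightarrow> M z_basis False x y - M z_basis True x y =
        z0 x * cnj (z0 y) - z1 x * cnj (z1 y)"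
    and Mx: "\<And>x y. x \<in> I \<Longrightarrow> y \<in> I \<Longrightarrow> M x_basis False x y - M x_basis True x y =
        c x * cnj (d y) + d x * cnj (c y)"
  shows "\<exists>F. squash_operator I M F"
proof -
  have sym: "ip I z1 z0 = 0" "ip I d c = 0" "ip I c z0 = of_real \<eta>" "ip I d z1 = of_real \<eta>"
    "ip I d z0 = 0" "ip I c z1 = 0"
    using ips(3,6-10)[THEN arg_cong, of cnj] by (simp_all add: cnj_ip)
  note ips' = ips sym
  define c' d' where "c' = tilt \<eta> c z0" and "d' = tilt \<eta> d z1"
  have deg: "c x = z0 x \<and> d x = z1 x" if "\<eta> = 1" "x \<in> I" for x
    using eq_if_ip_eq_1[OF I] that ips by auto
  have unit: "ip I (tilt \<eta> v z) (tilt \<eta> v z) = 1 \<or> (\<forall>x\<in>I. tilt \<eta> v z x = 0)"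
    if "ip I v v = 1" "ip I z z = 1" "ip I v z = of_real \<eta>" "ip I z v = of_real \<eta>" for v z
  proof (cases "\<eta> = 1")
    case False
    then have "\<eta>\<^sup>2 < 1" using \<eta> by (simp add: power_less_one_iff)
    define \<delta> where "\<delta> = complex_of_real (sqrt (1 - \<eta>\<^sup>2))"
    have \<delta>: "cnj \<delta> = \<delta>" "\<delta> * \<delta> = 1 - (of_real \<eta>)\<^sup>2" "\<delta> \<noteq> 0"
      using \<open>\<eta>\<^sup>2 < 1\<close> by (simp_all add: \<delta>_def flip: of_real_mult)
    have "ip I (tilt \<eta> v z) (tilt \<eta> v z) = (1 - (of_real \<eta>)\<^sup>2) / (\<delta> * \<delta>)"
      unfolding tilt_def \<delta>_def[symmetric] using that
      by (simp add: ip_simps \<delta>(1) power2_eq_square)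
    then show ?thesis using \<delta>(2,3) by (metis divide_self mult_eq_0_iff)
  qed (simp add: tilt_def)
  have "orthosystem I [z0, z1, c', d']"
    using unit[of c z0] unit[of d z1] by (auto simp: c'_def d'_def tilt_def ip_simps ips')
  from ex_rows_compl[OF I this]
  obtain fs where fs: "(\<Sum>f\<leftarrow>fs. f x * cnj (f y)) = of_bool (x = y)
      - (z0 x * cnj (z0 y) + (z1 x * cnj (z1 y) + (c' x * cnj (c' y) + d' x * cnj (d' y))))"
    if "x \<in> I" "y \<in> I" for x y
    unfolding compl_def by auto
  define c'' d'' where "c'' = tilt \<eta> z0 c" and "d'' = tilt \<eta> z1 d"
  have change: "z0 x * cnj (z0 y) + c' x * cnj (c' y) = c x * cnj (c y) + c'' x * cnj (c'' y)"
    "z1 x * cnj (z1 y) + d' x * cnj (d' y) = d x * cnj (d y) + d'' x * cnj (d'' y)"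
    "z0 x * cnj (z1 y) + c' x * cnj (d' y) = c x * cnj (d y) + c'' x * cnj (d'' y)"
    "z1 x * cnj (z0 y) + d' x * cnj (c' y) = d x * cnj (c y) + d'' x * cnj (c'' y)"
    if "x \<in> I" "y \<in> I" for x y
    unfolding c'_def d'_def c''_def d''_def using deg that
    by (auto intro!: tilt_basis_change[OF \<eta>])
  \<comment> \<open>By \<open>change\<close>, the last three of the explicit pairs contribute
    |z0><z1| + |c'><d'| - |c''><d''| = |c><d| and its adjoint, a second copy of M_x. Listing (d',
    c') in swapped order puts both |c'><c'| and |d'><d'| into each diagonal sum, where they cancel
    against \<open>fs\<close>.\<close>
  let ?ps = "(c, d) # (z0, z1) # (c'', \<lambda>x. - d'' x) # (d', c') #
      map (\<lambda>f. (f, \<lambda>_. 0)) fs @ map (\<lambda>f. (\<lambda>_. 0, f)) fs"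
  show ?thesis
  proof (rule squash_operator_exists_if[OF I, where ps = ?ps])
    fix x y assume xy: "x \<in> I" "y \<in> I"
    note ch = change[OF xy]
    show "(\<Sum>p\<leftarrow>?ps. fst p x * cnj (fst p y)) =
       of_bool (x = y) + (M z_basis False x y - M z_basis True x y)"
      using ch(1) by (simp add: o_def fs Mz xy algebra_simps)
    show "(\<Sum>p\<leftarrow>?ps. snd p x * cnj (snd p y)) =
       of_bool (x = y) - (M z_basis False x y - M z_basis True x y)"
      using ch(2) by (simp add: o_def fs Mz xy algebra_simps)
    show "(\<Sum>p\<leftarrow>?ps. fst p x * cnj (snd p y) + snd p x * cnj (fst p y)) =
       2 * (M x_basis False x y - M x_basis True x y)"
      unfolding Mx[OF xy] using ch(3,4) by (simp add: o_def) algebra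
  qed
qed

section \<open>Amplitudes and overlaps of the detector states\<close>

text \<open>
  \<open>amp r b N p q\<close> is the amplitude of \<open>(a\<^sup>\<dagger>\<^bsub>rb\<^esub>)\<^bsup>N\<^esup> |0\<rangle>\<close> (one mode) at \<open>p\<close> photons of bit value 0 and
  \<open>q\<close> photons of bit value 1.
\<close>

definition amp :: "bb84_basis \<Rightarrow> bool \<Rightarrow> nat \<Rightarrow> nat \<Rightarrow> nat \<Rightarrow> real" where
  "amp r b N p q = (if p + q \<noteq> N then 0 else case r of
       z_basis \<Rightarrow> (if (if b then p else q) = 0 then sqrt (fact N) else 0)
     | x_basis \<Rightarrow> (- 1) ^ (of_bool b * q) * fact N / (sqrt 2 ^ N * sqrt (fact p * fact q)))"

definition clear :: "nat \<Rightarrow> occupation \<Rightarrow> occupation" where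
  "clear i k = k((i, False) := 0, (i, True) := 0)"

lemma clear_upd [simp]: "clear i (k((i, b) := v)) = clear i k"
  by (cases b) (auto simp: clear_def fun_eq_iff)

lemma clear_apply: "clear i k (j, b) = (if j = i then 0 else k (j, b))"
  by (cases b) (auto simp: clear_def)

lemma clear_idem: "k (i, False) = 0 \<Longrightarrow> k (i, True) = 0 \<Longrightarrow> clear i k = k"
  by (auto simp: clear_def fun_eq_iff)

text \<open>The square roots from the creation operators turn the two terms into p and q times one
  common value, and p + q = \<open>Suc N\<close>.\<close>

lemma amp_x_Suc:
  assumes "p + q = Suc N"
  shows "(if p = 0 then 0 else sqrt p * amp x_basis b N (p - 1) q) +
     (- 1) ^ of_bool b * (if q = 0 then 0 else sqrt q * amp x_basis b N p (q - 1)) =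
     sqrt 2 * amp x_basis b (Suc N) p q"
proof -
  have red: "sqrt l / sqrt (fact (l - 1) * u) = l / sqrt (fact l * u)" if "l \<noteq> 0" "u > 0" for l :: nat and u
  proof -
    obtain j where l: "l = Suc j" using \<open>l \<noteq> 0\<close> by (cases l) auto
    have "sqrt (Suc j) * sqrt (Suc j) = Suc j" by simp
    then show ?thesis using \<open>u > 0\<close>
      unfolding l by (simp add: real_sqrt_mult field_simps del: of_nat_Suc)
  qed
  have P: "(if p = 0 then 0 else sqrt p * amp x_basis b N (p - 1) q) =
     p * ((- 1) ^ (of_bool b * q) * fact N / (sqrt 2 ^ N * sqrt (fact p * fact q)))"
  proof (cases "p = 0")
    case False
    have "sqrt p * amp x_basis b N (p - 1) q =
       (- 1) ^ (of_bool b * q) * fact N / sqrt 2 ^ N * (sqrt p / sqrt (fact (p - 1) * fact q))"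
      using assms False by (simp add: amp_def)
    also have "\<dots> = p * ((- 1) ^ (of_bool b * q) * fact N / (sqrt 2 ^ N * sqrt (fact p * fact q)))"
      using False by (subst red) simp_all
    finally show ?thesis by (simp only: False if_False)
  qed simp
  have Q: "(- 1) ^ of_bool b * (if q = 0 then 0 else sqrt q * amp x_basis b N p (q - 1)) =
     q * ((- 1) ^ (of_bool b * q) * fact N / (sqrt 2 ^ N * sqrt (fact p * fact q)))"
  proof (cases "q = 0")
    case False
    then have sgn: "(- 1 :: real) ^ of_bool b * (- 1) ^ (of_bool b * (q - 1)) = (- 1) ^ (of_bool b * q)"
      by (cases q) (auto simp: power_add)
    have "(- 1) ^ of_bool b * (sqrt q * amp x_basis b N p (q - 1)) =
       ((- 1) ^ of_bool b * (- 1) ^ (of_bool b * (q - 1))) * fact N / sqrt 2 ^ N *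
         (sqrt q / sqrt (fact (q - 1) * fact p))"
      using assms False by (simp add: amp_def mult_ac)
    also have "\<dots> = q * ((- 1) ^ (of_bool b * q) * fact N / (sqrt 2 ^ N * sqrt (fact p * fact q)))"
      unfolding sgn using False by (subst red) (simp_all add: mult_ac)
    finally show ?thesis by (simp only: False if_False)
  qed simp
  have "real p + real q = Suc N" using assms by linarith
  then have "p * v + q * v = Suc N * v" for v :: real
    by (metis distrib_right)
  moreover have "sqrt 2 * amp x_basis b (Suc N) p q =
      Suc N * ((- 1) ^ (of_bool b * q) * fact N / (sqrt 2 ^ N * sqrt (fact p * fact q)))"
    using assms by (simp add: amp_def del: of_nat_Suc)
  ultimately show ?thesis
    unfolding P Q by (simp only:)
qed

text \<open>The hypothesis says that \<psi> has no photon in mode i, so the amplitude splits into a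
  one-mode factor and the amplitude of the other modes.\<close>

lemma create_power:
  assumes \<psi>: "\<And>k. k (i, False) \<noteq> 0 \<or> k (i, True) \<noteq> 0 \<Longrightarrow> \<psi> k = 0"
  shows "(create r i b ^^ N) \<psi> k = of_real (amp r b N (k (i, False)) (k (i, True))) * \<psi> (clear i k)"
proof (induction N arbitrary: k)
  case 0
  show ?case
  proof (cases "k (i, False) = 0 \<and> k (i, True) = 0")
    case True
    then show ?thesis by (cases r) (auto simp: amp_def clear_idem)
  next
    case False
    then show ?thesis using \<psi>[of k] by (auto simp: amp_def)
  qed
next
  case (Suc N)
  let ?p = "k (i, False)" and ?q = "k (i, True)" and ?\<phi> = "(create r i b ^^ N) \<psi>"
  have F: "create_z i False ?\<phi> k = of_real (if ?p = 0 then 0 else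
      sqrt ?p * amp r b N (?p - 1) ?q) * \<psi> (clear i k)"
    by (simp only: create_z_def Suc.IH clear_upd) simp
  have T: "create_z i True ?\<phi> k = of_real (if ?q = 0 then 0 else
      sqrt ?q * amp r b N ?p (?q - 1)) * \<psi> (clear i k)"
    by (simp only: create_z_def Suc.IH clear_upd) simp
  show ?case
  proof (cases r)
    case z_basis
    have step: "fact l = real l * fact (l - Suc 0)" if "l \<noteq> 0" for l
      using that by (simp add: fact_reduce)
    have "(create r i b ^^ Suc N) \<psi> k = create_z i b ?\<phi> k"
      by (simp add: z_basis create_def)
    also have "\<dots> = of_real (amp r b (Suc N) ?p ?q) * \<psi> (clear i k)"
    proof (cases b)
      case True
      then have "create_z i b ?\<phi> k = create_z i True ?\<phi> k" by (simp only:)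
      also note T
      also have "(if ?q = 0 then 0 else sqrt ?q * amp r b N ?p (?q - 1)) = amp r b (Suc N) ?p ?q"
        using True z_basis step[of ?q] by (auto simp: amp_def real_sqrt_mult)
      finally show ?thesis .
    next
      case False
      then have "create_z i b ?\<phi> k = create_z i False ?\<phi> k" by (simp only:)
      also note F
      also have "(if ?p = 0 then 0 else sqrt ?p * amp r b N (?p - 1) ?q) = amp r b (Suc N) ?p ?q"
        using False z_basis step[of ?p] by (auto simp: amp_def real_sqrt_mult)
      finally show ?thesis .
    qed
    finally show ?thesis .
  next
    case x_basis
    have "create r i b ?\<phi> k = (create_z i False ?\<phi> k + (- 1) ^ of_bool b * create_z i True ?\<phi> k) /
        of_real (sqrt 2)"
      by (simp add: x_basis create_def)
    also have "\<dots> = of_real (((if ?p = 0 then 0 else sqrt ?p * amp r b N (?p - 1) ?q) +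
        (- 1) ^ of_bool b * (if ?q = 0 then 0 else sqrt ?q * amp r b N ?p (?q - 1))) / sqrt 2) *
        \<psi> (clear i k)"
      unfolding F T by (simp add: algebra_simps add_divide_distrib)
    also have "((if ?p = 0 then 0 else sqrt ?p * amp r b N (?p - 1) ?q) +
        (- 1) ^ of_bool b * (if ?q = 0 then 0 else sqrt ?q * amp r b N ?p (?q - 1))) / sqrt 2 =
        amp r b (Suc N) ?p ?q"
    proof (cases "?p + ?q = Suc N")
      case True
      then show ?thesis unfolding x_basis amp_x_Suc[OF True] by simp
    qed (auto simp: amp_def)
    finally show ?thesis by simp
  qed
qed

text \<open>Distinctness guarantees that the modes already processed leave mode j empty, as
  \<open>create_power\<close> requires.\<close>

lemma foldr_create:
  assumes "distinct ms"
  shows "foldr (\<lambda>i \<psi>. (create r i b ^^ n i) \<psi>) ms vacuum k =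
    of_real (\<Prod>i\<in>set ms. amp r b (n i) (k (i, False)) (k (i, True))) *
    of_bool (\<forall>i c. i \<notin> set ms \<longrightarrow> k (i, c) = 0)"
  using assms
proof (induction ms arbitrary: k)
  case Nil
  then show ?case by (auto simp: vacuum_def fun_eq_iff)
next
  case (Cons j js)
  let ?\<psi> = "foldr (\<lambda>i \<psi>. (create r i b ^^ n i) \<psi>) js vacuum"
  have "(create r j b ^^ n j) ?\<psi> k =
      of_real (amp r b (n j) (k (j, False)) (k (j, True))) * ?\<psi> (clear j k)"
  proof (rule create_power)
    fix k :: occupation
    assume "k (j, False) \<noteq> 0 \<or> k (j, True) \<noteq> 0"
    then show "?\<psi> k = 0" using Cons by auto
  qed
  moreover have "(\<Prod>i\<in>set js. amp r b (n i) (clear j k (i, False)) (clear j k (i, True))) =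
      (\<Prod>i\<in>set js. amp r b (n i) (k (i, False)) (k (i, True)))"
    using Cons.prems by (intro prod.cong) (auto simp: clear_apply)
  moreover have "(\<forall>i c. i \<notin> set js \<longrightarrow> clear j k (i, c) = 0) \<longleftrightarrow>
      (\<forall>i c. i \<notin> set (j # js) \<longrightarrow> k (i, c) = 0)"
    by (auto simp: clear_apply)
  ultimately show ?case using Cons by (simp del: of_real_prod)
qed

lemma raw_ket_eq:
  assumes "k \<in> occupations m n"
  shows "raw_ket m n r b k = of_real (\<Prod>i=1..m. amp r b (n i) (k (i, False)) (k (i, True)))"
proof -
  have "set [1..<Suc m] = {1..m}" by auto
  moreover have "\<forall>i c. i \<notin> {1..m} \<longrightarrow> k (i, c) = 0"
    using assms unfolding occupations_def by blast
  ultimately show ?thesis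
    unfolding raw_ket_def by (subst foldr_create) (simp_all del: upt_Suc)
qed

text \<open>An occupation is determined by its number j of bit-1 photons in each mode, chosen
  independently from 0 to \<open>n i\<close>.\<close>

lemma sum_occupations_prod:
  fixes h :: "nat \<Rightarrow> nat \<Rightarrow> nat \<Rightarrow> real"
  shows "(\<Sum>k\<in>occupations m n. \<Prod>i=1..m. h i (k (i, False)) (k (i, True))) =
    (\<Prod>i=1..m. \<Sum>j\<le>n i. h i (n i - j) j)"
proof -
  let ?E = "PiE {1..m} (\<lambda>i. {..n i})"
  let ?to = "\<lambda>g (i, b). if i \<in> {1..m} then if b then g i else n i - g i else (0 :: nat)"
  have "(\<Prod>i=1..m. \<Sum>j\<le>n i. h i (n i - j) j) = (\<Sum>g\<in>?E. \<Prod>i=1..m. h i (n i - g i) (g i))"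
    by (rule prod_sum_PiE) auto
  also have "\<dots> = (\<Sum>k\<in>occupations m n. \<Prod>i=1..m. h i (k (i, False)) (k (i, True)))"
  proof (rule sum.reindex_bij_witness[where i = "\<lambda>k. \<lambda>i\<in>{1..m}. k (i, True)" and j = ?to])
    fix k assume k: "k \<in> occupations m n"
    then have n: "n i = k (i, False) + k (i, True)" if "i \<in> {1..m}" for i
      using that by (simp add: occupations_def)
    have zero: "k (i, b) = 0" if "i \<notin> {1..m}" for i b
      using k that unfolding occupations_def by blast
    show "?to (\<lambda>i\<in>{1..m}. k (i, True)) = k"
      using zero by (auto simp: fun_eq_iff n simp del: atLeastAtMost_iff)
    show "(\<lambda>i\<in>{1..m}. k (i, True)) \<in> ?E"
      using n by auto
  next
    fix g assume g: "g \<in> ?E"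
    then have le: "g i \<le> n i" if "i \<in> {1..m}" for i using that by auto
    show "(\<lambda>i\<in>{1..m}. ?to g (i, True)) = g"
      using g by (auto simp: fun_eq_iff PiE_def extensional_def)
    show "?to g \<in> occupations m n"
      using le by (auto simp: occupations_def)
    show "(\<Prod>i=1..m. h i (?to g (i, False)) (?to g (i, True))) = (\<Prod>i=1..m. h i (n i - g i) (g i))"
      by (intro prod.cong) auto
  qed
  finally show ?thesis by simp
qed

section \<open>Overlaps, mode by mode and in total\<close>

definition overlap :: "bb84_basis \<Rightarrow> bool \<Rightarrow> bb84_basis \<Rightarrow> bool \<Rightarrow> nat \<Rightarrow> real" where
  "overlap r b r' b' N = (\<Sum>j\<le>N. amp r b N (N - j) j * amp r' b' N (N - j) j)"

lemma ip_raw_ket: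
  "ip (occupations m n) (raw_ket m n r b) (raw_ket m n r' b') =
     of_real (\<Prod>i=1..m. overlap r b r' b' (n i))"
proof -
  have "ip (occupations m n) (raw_ket m n r b) (raw_ket m n r' b') =
     of_real (\<Sum>k\<in>occupations m n. \<Prod>i=1..m.
       amp r b (n i) (k (i, False)) (k (i, True)) * amp r' b' (n i) (k (i, False)) (k (i, True)))"
    unfolding ip_def of_real_sum
    by (intro sum.cong refl) (simp add: raw_ket_eq prod.distrib)
  then show ?thesis
    unfolding overlap_def by (subst (asm) sum_occupations_prod)
qed

text \<open>The factor \<open>0 ^ N\<close> covers an empty mode: for \<open>N = 0\<close> both bit
  values give the vacuum, with overlap 1.\<close>

lemma overlap_zz: "overlap z_basis b z_basis b' N = (if b = b' then fact N else fact N * 0 ^ N)"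
proof -
  have "overlap z_basis b z_basis b' N =
     (\<Sum>j\<le>N. if j = (if b then N else 0) \<and> j = (if b' then N else 0) then fact N else 0)"
    unfolding overlap_def by (intro sum.cong refl) (auto simp: amp_def)
  also have "\<dots> = (if b = b' then fact N else fact N * 0 ^ N)"
  proof (cases "b = b' \<or> N = 0")
    case False
    then show ?thesis by (auto simp: zero_power intro!: sum.neutral)
  qed (auto simp: sum.delta)
  finally show ?thesis .
qed

lemma overlap_zx:
  "overlap z_basis b x_basis b' N = (- 1) ^ (of_bool (b \<and> b') * N) * fact N / sqrt 2 ^ N"
proof -
  have "overlap z_basis b x_basis b' N =
     (\<Sum>j\<le>N. if j = (if b then N else 0) then (- 1) ^ (of_bool (b \<and> b') * N) * fact N / sqrt 2 ^ N else 0)"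
    unfolding overlap_def by (intro sum.cong refl) (auto simp: amp_def)
  then show ?thesis by (auto simp: sum.delta)
qed

text \<open>The products of amplitudes are binomial coefficients with sign \<open>s ^ j\<close>, so
  the binomial theorem gives (1 + s)^N, that is 2^N or 0^N.\<close>

lemma overlap_xx: "overlap x_basis b x_basis b' N = (if b = b' then fact N else fact N * 0 ^ N)"
proof -
  define s :: real where "s = (if b = b' then 1 else - 1)"
  have "overlap x_basis b x_basis b' N = (\<Sum>j\<le>N. fact N / 2 ^ N * ((N choose j) * s ^ j))"
    unfolding overlap_def
  proof (intro sum.cong refl)
    fix j assume "j \<in> {..N}"
    then have j: "j \<le> N" by simp
    have sgn: "(- 1) ^ (of_bool b * j) * (- 1) ^ (of_bool b' * j) = s ^ j"
      by (cases b; cases b') (simp_all add: s_def flip: power_mult_distrib)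
    have sq2: "sqrt 2 ^ N * sqrt 2 ^ N = (2 :: real) ^ N"
      by (simp flip: power_mult_distrib)
    have amp: "amp x_basis b N (N - j) j =
      (- 1) ^ (of_bool b * j) * fact N / (sqrt 2 ^ N * sqrt (fact (N - j) * fact j))" for b
      using j by (simp add: amp_def)
    have "amp x_basis b N (N - j) j * amp x_basis b' N (N - j) j =
      ((- 1) ^ (of_bool b * j) * (- 1) ^ (of_bool b' * j)) * (fact N * fact N) /
      ((sqrt 2 ^ N * sqrt 2 ^ N) *
       (sqrt (fact (N - j) * fact j) * sqrt (fact (N - j) * fact j)))"
      unfolding amp by (simp only: times_divide_times_eq mult_ac)
    also have "\<dots> = s ^ j * (fact N * fact N) / (2 ^ N * (fact (N - j) * fact j))"
      unfolding sgn sq2 by simp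
    also have "\<dots> = fact N / 2 ^ N * ((N choose j) * s ^ j)"
      using j by (simp add: binomial_fact field_simps)
    finally show "amp x_basis b N (N - j) j * amp x_basis b' N (N - j) j =
      fact N / 2 ^ N * ((N choose j) * s ^ j)" .
  qed
  also have "\<dots> = fact N / 2 ^ N * (s + 1) ^ N"
    by (simp add: binomial_ring sum_distrib_left sum_divide_distrib mult.assoc)
  also have "\<dots> = (if b = b' then fact N else fact N * 0 ^ N)"
    by (simp add: s_def power_0_left)
  finally show ?thesis .
qed

lemma ip_ket:
  "ip (occupations m n) (ket m n r b) (ket m n r' b') =
     of_real ((\<Prod>i=1..m. overlap r b r' b' (n i)) / (\<Prod>i=1..m. fact (n i)))"
proof -
  let ?I = "occupations m n" and ?\<Phi> = "\<Prod>i=1..m. fact (n i) :: real"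
  have "(\<Sum>k\<in>?I. (cmod (raw_ket m n r b k))\<^sup>2) = ?\<Phi>" for r b
  proof -
    have "complex_of_real (\<Sum>k\<in>?I. (cmod (raw_ket m n r b k))\<^sup>2) = ip ?I (raw_ket m n r b) (raw_ket m n r b)"
      unfolding ip_def of_real_sum by (intro sum.cong refl) (metis complex_norm_square mult.commute)
    also have "\<dots> = of_real ?\<Phi>"
      by (cases r) (simp_all add: ip_raw_ket overlap_zz overlap_xx)
    finally show ?thesis by (simp only: of_real_eq_iff)
  qed
  then have "ip ?I (ket m n r b) (ket m n r' b') =
     ip ?I (raw_ket m n r b) (raw_ket m n r' b') / (of_real (sqrt ?\<Phi>) * of_real (sqrt ?\<Phi>))"
    unfolding ket_def by (simp add: ip_simps)
  moreover have "sqrt ?\<Phi> * sqrt ?\<Phi> = ?\<Phi>"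
    by (simp add: prod_nonneg)
  ultimately show ?thesis
    by (simp only: ip_raw_ket flip: of_real_mult of_real_divide)
qed

text \<open>Empty modes do not distinguish the bit values, but one photon anywhere does: the product
  of all \<open>0 ^ n i\<close> is 0 to the total photon number.\<close>

lemma ip_ket_same_basis:
  assumes "(\<Sum>i=1..m. n i) \<ge> 1"
  shows "ip (occupations m n) (ket m n r b) (ket m n r b') = of_bool (b = b')"
proof -
  have "(\<Prod>i=1..m. fact (n i) * 0 ^ n i :: real) = 0"
  proof -
    have "(\<Prod>i=1..m. 0 ^ n i :: real) = 0"
      using assms by (simp flip: power_sum)
    then show ?thesis by (simp add: prod.distrib)
  qed
  then show ?thesis
    by (cases r; cases "b = b'") (simp_all add: ip_ket overlap_zz overlap_xx)
qed

lemma ip_ket_zx: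
  "ip (occupations m n) (ket m n z_basis b) (ket m n x_basis b') =
     of_real ((- 1) ^ (of_bool (b \<and> b') * (\<Sum>i=1..m. n i)) / sqrt 2 ^ (\<Sum>i=1..m. n i))"
proof -
  have "(\<Prod>i=1..m. (- 1) ^ (of_bool (b \<and> b') * n i) * fact (n i) / sqrt 2 ^ n i) =
    (- 1) ^ (of_bool (b \<and> b') * (\<Sum>i=1..m. n i)) * (\<Prod>i=1..m. fact (n i) :: real) / sqrt 2 ^ (\<Sum>i=1..m. n i)"
    by (simp add: prod.distrib prod_dividef sum_distrib_left power_sum)
  then show ?thesis
    by (simp add: ip_ket overlap_zx)
qed

section \<open>Choice of the construction by parity\<close>

theorem mainTheorem3:
  fixes m :: nat and n :: "nat \<Rightarrow> nat"
  assumes "m \<ge> 1"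
    and "(\<Sum>i=1..m. n i) \<ge> 1"
  shows "\<exists>F. squash_operator (occupations m n) (threshold_povm m n) F"
proof -
  let ?I = "occupations m n" and ?s = "complex_of_real (sqrt 2)"
  define N where "N = (\<Sum>i=1..m. n i)"
  \<comment> \<open>Both x kets overlap z0 by 1 / sqrt 2 ^ N, so c overlaps it by twice this over
    sqrt 2.\<close>
  define \<theta> where "\<theta> = sqrt 2 / sqrt 2 ^ N"
  define z0 z1 x0 x1 where kets: "z0 = ket m n z_basis False" "z1 = ket m n z_basis True"
    "x0 = ket m n x_basis False" "x1 = ket m n x_basis True"
  define c d where cd: "c = (\<lambda>k. (x0 k + x1 k) / ?s)" "d = (\<lambda>k. (x0 k - x1 k) / ?s)"
  have s: "?s * ?s = 2" by (simp flip: of_real_mult)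
  have diff: "threshold_povm m n r False x y - threshold_povm m n r True x y =
      ket m n r False x * cnj (ket m n r False y) - ket m n r True x * cnj (ket m n r True y)" for r x y
    by (simp add: threshold_povm_def projector_def)
  have Mz: "threshold_povm m n z_basis False x y - threshold_povm m n z_basis True x y =
      z0 x * cnj (z0 y) - z1 x * cnj (z1 y)" for x y
    unfolding diff kets ..
  have Mx: "threshold_povm m n x_basis False x y - threshold_povm m n x_basis True x y =
      c x * cnj (d y) + d x * cnj (c y)" for x y
    unfolding diff kets[symmetric] cd by (simp add: s) (simp add: field_simps)
  note zx = ip_ket_zx[of m n, folded N_def]
  note same = ip_ket_same_basis[OF assms(2)]
  have ips: "ip ?I z0 z0 = 1" "ip ?I z1 z1 = 1" "ip ?I z0 z1 = 0"
      "ip ?I c c = 1" "ip ?I d d = 1" "ip ?I c d = 0" "ip ?I z0 d = 0"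
    unfolding cd kets by (simp_all add: ip_simps same s zx)
  have z0c: "ip ?I z0 c = of_real \<theta>"
  proof -
    have "(1 / sqrt 2 ^ N + 1 / sqrt 2 ^ N) / sqrt 2 = \<theta>"
      by (simp add: \<theta>_def field_simps)
    then show ?thesis
      unfolding cd kets by (simp add: ip_simps zx flip: of_real_add of_real_divide of_real_power)
  qed
  show ?thesis
  \<comment> \<open><z1|x1> is (-1)^N times <z1|x0>, so z1 overlaps only c for even N and only d for
    odd N.\<close>
  proof (cases "even N")
    case True
    then have "ip ?I z1 c = ip ?I z0 c" "ip ?I z1 d = 0"
      unfolding cd kets by (simp_all add: ip_simps zx)
    then show ?thesis
      using squash_operator_exists_even[OF finite_occupations ips(1-6) z0c _ ips(7) _ Mz Mx] z0c by simp
  next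
    case False
    then have "ip ?I z1 d = ip ?I z0 c" "ip ?I z1 c = 0"
      unfolding cd kets by (simp_all add: ip_simps zx)
    moreover have "\<theta> \<le> 1"
    proof -
      have "sqrt 2 ^ 1 \<le> sqrt 2 ^ N"
        using assms(2) by (intro power_increasing) (auto simp: N_def)
      then show ?thesis by (simp add: \<theta>_def)
    qed
    moreover have "0 \<le> \<theta>" by (simp add: \<theta>_def)
    ultimately show ?thesis
      using squash_operator_exists_odd[OF finite_occupations _ _ ips(1-6) z0c _ ips(7) _ Mz Mx] z0c by simp
  qed
qed

end
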